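(* Let $\lambda>0$ and suppose $(h,c)$, with $h\colon\mathcal{X}\to\mathcal{Y}$ and $c\colon\mathcal{X}\to[0,1]$, is an optimal solution to the bounded-improvement problem $$\max_{h,c}\ \phi(c)\quad\text{s.t.}\quad R_S(h,c)\le\lambda .$$ Let $h_B\colon\mathcal{X}\to\mathcal{Y}$ be a Bayes classifier, i.e. $h_B(x)\in\operatorname{argmin}_{\hat y\in\mathcal{Y}}\sum_{y\in\mathcal{Y}}p(y\mid x)\,\ell(y,\hat y)$ for every $x\in\mathcal{X}$. Then $(h_B,c)$ is also an optimal solution to this problem.
   Context: $\mathcal{X}$ is a set of inputs (a measurable space with a fixed reference measure $dx$), $\mathcal{Y}$ is a finite set of labels, $p(x,y)$ is a probability density on $\mathcal{X}\times\mathcal{Y}$ (with respect to $dx$ times counting measure), $p(x)=\sum_{y\in\mathcal{Y}}p(x,y)$ is its marginal, and $p(y\mid x)$ is the conditional distribution, so $p(x,y)=p(x)p(y\mid x)$. $\ell\colon\mathcal{Y}\times\mathcal{Y}\to[0,\infty)$ is a loss. A classifier is a function $h\colon\mathcal{X}\to\mathcal{Y}$, a selection function is a function $c\colon\mathcal{X}\to[0,1]$; all functions are taken measurable. The coverage of $c$ is $\phi(c)=\int_{\mathcal{X}}p(x)c(x)\,dx$, and the selective risk of $(h,c)$ is $$R_S(h,c)=\frac{\int_{\mathcal{X}}\sum_{y\in\mathcal{Y}}p(x,y)\,\ell(y,h(x))\,c(x)\,dx}{\phi(c)},$$ defined when $\phi(c)\neq 0$. A pair $(h,c)$ is feasible only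 if $R_S(h,c)$ is defined. It is assumed that maximizers of the problem exist. *)

theory Defs
  imports "HOL-Probability.Probability"
begin

text \<open>The reference measure \<open>dx\<close> on the input space is a measure \<open>M\<close>, with inputs ranging over
  \<open>space M\<close>; the finite label set is a type of class \<open>finite\<close> with the discrete sigma-algebra.\<close>

definition joint_density :: "'x measure \<Rightarrow> ('x \<times> 'y::finite \<Rightarrow> real) \<Rightarrow> bool" where
  "joint_density M p \<longleftrightarrow>
     p \<in> borel_measurable (M \<Otimes>\<^sub>M count_space UNIV) \<and>
     (\<forall>x\<in>space M. \<forall>y. 0 \<le> p (x, y)) \<and>
     prob_space (density (M \<Otimes>\<^sub>M count_space UNIV) (\<lambda>z. ennreal (p z)))"

definition marginal :: "('x \<times> 'y::finite \<Rightarrow> real) \<Rightarrow> 'x \<Rightarrow> real" where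
  "marginal p x = (\<Sum>y\<in>UNIV. p (x, y))"

text \<open>\<open>q x y\<close> stands for \<open>p(y | x)\<close>. Where the marginal vanishes, \<open>q x\<close> may be any
  probability distribution on the labels.\<close>

definition conditional_distribution ::
  "'x measure \<Rightarrow> ('x \<times> 'y::finite \<Rightarrow> real) \<Rightarrow> ('x \<Rightarrow> 'y \<Rightarrow> real) \<Rightarrow> bool" where
  "conditional_distribution M p q \<longleftrightarrow>
     (\<forall>y. (\<lambda>x. q x y) \<in> borel_measurable M) \<and>
     (\<forall>x\<in>space M. (\<forall>y. 0 \<le> q x y) \<and> (\<Sum>y\<in>UNIV. q x y) = 1 \<and>
        (\<forall>y. p (x, y) = marginal p x * q x y))"

definition classifier :: "'x measure \<Rightarrow> ('x \<Rightarrow> 'y::finite) \<Rightarrow> bool" where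
  "classifier M h \<longleftrightarrow> h \<in> M \<rightarrow>\<^sub>M count_space UNIV"

definition selection_function :: "'x measure \<Rightarrow> ('x \<Rightarrow> real) \<Rightarrow> bool" where
  "selection_function M c \<longleftrightarrow> c \<in> borel_measurable M \<and> (\<forall>x\<in>space M. c x \<in> {0..1})"

definition coverage ::
  "'x measure \<Rightarrow> ('x \<times> 'y::finite \<Rightarrow> real) \<Rightarrow> ('x \<Rightarrow> real) \<Rightarrow> real" where
  "coverage M p c = (\<integral>x. marginal p x * c x \<partial>M)"

text \<open>Meaningful only if the coverage is nonzero; feasibility below requires this explicitly,
  since division by zero yields zero.\<close>

definition selective_risk ::
  "'x measure \<Rightarrow> ('x \<times> 'y::finite \<Rightarrow> real) \<Rightarrow> ('y \<Rightarrow> 'y \<Rightarrow> real) \<Rightarrow>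
   ('x \<Rightarrow> 'y) \<Rightarrow> ('x \<Rightarrow> real) \<Rightarrow> real" where
  "selective_risk M p l h c =
     (\<integral>x. (\<Sum>y\<in>UNIV. p (x, y) * l y (h x)) * c x \<partial>M) / coverage M p c"

definition bounded_improvement_feasible ::
  "'x measure \<Rightarrow> ('x \<times> 'y::finite \<Rightarrow> real) \<Rightarrow> ('y \<Rightarrow> 'y \<Rightarrow> real) \<Rightarrow> real \<Rightarrow>
   ('x \<Rightarrow> 'y) \<times> ('x \<Rightarrow> real) \<Rightarrow> bool" where
  "bounded_improvement_feasible M p l lam = (\<lambda>(h, c).
     classifier M h \<and> selection_function M c \<and>
     coverage M p c \<noteq> 0 \<and> selective_risk M p l h c \<le> lam)"

definition bounded_improvement_optimal ::
  "'x measure \<Rightarrow> ('x \<times> 'y::finite \<Rightarrow> real) \<Rightarrow> ('y \<Rightarrow> 'y \<Rightarrow> real) \<Rightarrow> real \<Rightarrow>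
   ('x \<Rightarrow> 'y) \<times> ('x \<Rightarrow> real) \<Rightarrow> bool" where
  "bounded_improvement_optimal M p l lam =
     is_arg_max (\<lambda>(h, c). coverage M p c) (bounded_improvement_feasible M p l lam)"

definition bayes_classifier ::
  "'x measure \<Rightarrow> ('x \<Rightarrow> 'y::finite \<Rightarrow> real) \<Rightarrow> ('y \<Rightarrow> 'y \<Rightarrow> real) \<Rightarrow> ('x \<Rightarrow> 'y) \<Rightarrow> bool" where
  "bayes_classifier M q l h \<longleftrightarrow> classifier M h \<and>
     (\<forall>x\<in>space M. is_arg_min (\<lambda>y'. \<Sum>y\<in>UNIV. q x y * l y y') (\<lambda>_. True) (h x))"

end

theory Submission imports Defs begin

text \<open>At each input the Bayes label minimises \<open>\<Sum>y. p (x, y) * l y y'\<close>, which is the conditional risk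
  scaled by the marginal. Hence replacing \<open>h\<close> by \<open>hB\<close> cannot increase the numerator of the
  selective risk, while the coverage does not depend on the classifier at all.\<close>

lemma marginal_nonneg:
  assumes "joint_density M p" "x \<in> space M"
  shows "0 \<le> marginal p x"
  using assms by (auto simp: joint_density_def marginal_def intro: sum_nonneg)

lemma joint_density_measurable_fst:
  assumes "joint_density M p"
  shows "(\<lambda>x. p (x, y)) \<in> borel_measurable M"
proof -
  have [measurable]: "p \<in> borel_measurable (M \<Otimes>\<^sub>M count_space UNIV)"
    using assms by (simp add: joint_density_def)
  show ?thesis by measurable
qed

text \<open>By Tonelli, the integral of the marginal over \<open>M\<close> is the total mass of the
  joint density, which is 1. This supplies the dominating function for the loss integrals
  below.\<close>

lemma integrable_marginal:
  fixes p :: "'x \<times> 'y::finite \<Rightarrow> real"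
  assumes "joint_density M p"
  shows "integrable M (marginal p)"
proof (rule integrableI_nonneg)
  let ?C = "count_space (UNIV :: 'y set)"
  \<comment> \<open>The exchange of integrals via \<open>C.nn_integral_fst\<close> asks for
    sigma-finiteness of the inner factor, here counting measure on a finite type.\<close>
  interpret C: sigma_finite_measure ?C
    by (rule sigma_finite_measure_count_space_finite) simp
  have p [measurable]: "p \<in> borel_measurable (M \<Otimes>\<^sub>M ?C)"
    and nonneg: "\<And>x y. x \<in> space M \<Longrightarrow> 0 \<le> p (x, y)"
    and prob: "prob_space (density (M \<Otimes>\<^sub>M ?C) (\<lambda>z. ennreal (p z)))"
    using assms by (auto simp: joint_density_def)
  have "(\<integral>\<^sup>+x. ennreal (marginal p x) \<partial>M) = (\<integral>\<^sup>+x. \<integral>\<^sup>+y. ennreal (p (x, y)) \<partial>?C \<partial>M)"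
    by (intro nn_integral_cong)
      (simp add: marginal_def nn_integral_count_space_finite sum_ennreal nonneg)
  also have "\<dots> = (\<integral>\<^sup>+z. ennreal (p z) \<partial>(M \<Otimes>\<^sub>M ?C))"
    by (rule C.nn_integral_fst) measurable
  also have "\<dots> = 1"
    using prob_space.emeasure_space_1[OF prob]
    by (simp add: emeasure_density nn_integral_set_ennreal[symmetric] cong: nn_integral_cong)
  finally show "(\<integral>\<^sup>+x. ennreal (marginal p x) \<partial>M) < \<infinity>" by simp
  show "marginal p \<in> borel_measurable M"
    unfolding marginal_def [abs_def]
    by (intro borel_measurable_sum joint_density_measurable_fst assms)
  show "AE x in M. 0 \<le> marginal p x"
    using marginal_nonneg[OF assms] by (auto intro: AE_I2)
qed

text \<open>Finitely many labels make the loss bounded and \<open>c\<close> takes values in [0,1],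
  so a constant multiple of the marginal dominates the integrand. Integrability matters for
  comparing risks: the Bochner integral of a non-integrable function defaults to 0.\<close>

lemma integrable_selective_loss:
  fixes p :: "'x \<times> 'y::finite \<Rightarrow> real"
  assumes p: "joint_density M p" and h: "classifier M h" and c: "selection_function M c"
  shows "integrable M (\<lambda>x. (\<Sum>y\<in>UNIV. p (x, y) * l y (h x)) * c x)"
proof (rule Bochner_Integration.integrable_bound)
  \<comment> \<open>A crude uniform bound: each absolute loss value is one summand of this finite
    sum of nonnegative terms.\<close>
  let ?K = "\<Sum>y\<in>UNIV. \<Sum>y'\<in>UNIV. \<bar>l y y'\<bar>"
  show "integrable M (\<lambda>x. ?K * marginal p x)"
    using integrable_marginal[OF p] by simp
  have [measurable]: "h \<in> M \<rightarrow>\<^sub>M count_space UNIV" "c \<in> borel_measurable M"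
    using h c by (auto simp: classifier_def selection_function_def)
  note joint_density_measurable_fst[OF p, measurable]
  show "(\<lambda>x. (\<Sum>y\<in>UNIV. p (x, y) * l y (h x)) * c x) \<in> borel_measurable M"
    by measurable
  show "AE x in M. norm ((\<Sum>y\<in>UNIV. p (x, y) * l y (h x)) * c x) \<le> norm (?K * marginal p x)"
  proof (rule AE_I2)
    fix x assume x: "x \<in> space M"
    have p0: "0 \<le> p (x, y)" for y
      using p x by (simp add: joint_density_def)
    have bound: "\<bar>l y y'\<bar> \<le> ?K" for y y'
    proof -
      have "\<bar>l y y'\<bar> \<le> (\<Sum>y'\<in>UNIV. \<bar>l y y'\<bar>)"
        by (rule member_le_sum) auto
      also have "\<dots> \<le> ?K"
        by (rule member_le_sum[where f = "\<lambda>y. \<Sum>y'\<in>UNIV. \<bar>l y y'\<bar>"]) (auto intro: sum_nonneg)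
      finally show ?thesis .
    qed
    have "\<bar>\<Sum>y\<in>UNIV. p (x, y) * l y (h x)\<bar> \<le> (\<Sum>y\<in>UNIV. \<bar>p (x, y) * l y (h x)\<bar>)"
      by (rule sum_abs)
    also have "\<dots> \<le> (\<Sum>y\<in>UNIV. p (x, y) * ?K)"
      by (intro sum_mono) (simp add: abs_mult p0 bound mult_left_mono)
    also have "\<dots> = ?K * marginal p x"
      by (simp add: marginal_def sum_distrib_right[symmetric] mult.commute)
    finally have *: "\<bar>\<Sum>y\<in>UNIV. p (x, y) * l y (h x)\<bar> \<le> ?K * marginal p x" .
    have "0 \<le> c x" "c x \<le> 1"
      using c x by (auto simp: selection_function_def)
    then have "\<bar>(\<Sum>y\<in>UNIV. p (x, y) * l y (h x)) * c x\<bar> \<le> \<bar>\<Sum>y\<in>UNIV. p (x, y) * l y (h x)\<bar>"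
      by (simp add: abs_mult mult_left_le)
    with * show "norm ((\<Sum>y\<in>UNIV. p (x, y) * l y (h x)) * c x) \<le> norm (?K * marginal p x)"
      by simp
  qed
qed

text \<open>Multiplying the inequality between conditional risks by the marginal avoids any
  division, so inputs with zero marginal need no separate case: both sides are 0 there, whichever
  distribution \<open>q x\<close> is.\<close>

lemma bayes_classifier_pointwise_le:
  assumes p: "joint_density M p" and q: "conditional_distribution M p q"
    and hB: "bayes_classifier M q l hB" and x: "x \<in> space M"
  shows "(\<Sum>y\<in>UNIV. p (x, y) * l y (hB x)) \<le> (\<Sum>y\<in>UNIV. p (x, y) * l y y')"
proof -
  have eq: "(\<Sum>y\<in>UNIV. p (x, y) * l y z) = marginal p x * (\<Sum>y\<in>UNIV. q x y * l y z)" for z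
    using q x by (simp add: conditional_distribution_def sum_distrib_left mult.assoc)
  have "(\<Sum>y\<in>UNIV. q x y * l y (hB x)) \<le> (\<Sum>y\<in>UNIV. q x y * l y y')"
    using hB x by (auto simp: bayes_classifier_def is_arg_min_linorder)
  then show ?thesis
    unfolding eq by (rule mult_left_mono) (rule marginal_nonneg[OF p x])
qed

lemma coverage_nonneg:
  assumes "joint_density M p" "selection_function M c"
  shows "0 \<le> coverage M p c"
  unfolding coverage_def using assms
  by (intro Bochner_Integration.integral_nonneg)
    (auto simp: selection_function_def intro!: mult_nonneg_nonneg marginal_nonneg)

lemma selective_risk_bayes_le:
  fixes p :: "'x \<times> 'y::finite \<Rightarrow> real"
  assumes p: "joint_density M p" and q: "conditional_distribution M p q"
    and l: "\<And>y y'. 0 \<le> l y y'"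
    and hB: "bayes_classifier M q l hB"
    and h: "classifier M h" and c: "selection_function M c"
  shows "selective_risk M p l hB c \<le> selective_risk M p l h c"
  unfolding selective_risk_def
\<comment> \<open>\<open>integral_mono'\<close> asks for integrability and nonnegativity of the
  larger integrand only; the latter is where the sign of the loss enters. A zero coverage is
  harmless, as both quotients are then 0.\<close>
proof (rule divide_right_mono[OF _ coverage_nonneg[OF p c]], rule integral_mono')
  show "integrable M (\<lambda>x. (\<Sum>y\<in>UNIV. p (x, y) * l y (h x)) * c x)"
    by (rule integrable_selective_loss[OF p h c])
  fix x assume x: "x \<in> space M"
  have c0: "0 \<le> c x"
    using c x by (simp add: selection_function_def)
  show "(\<Sum>y\<in>UNIV. p (x, y) * l y (hB x)) * c x \<le> (\<Sum>y\<in>UNIV. p (x, y) * l y (h x)) * c x"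
    by (rule mult_right_mono[OF bayes_classifier_pointwise_le[OF p q hB x] c0])
  show "0 \<le> (\<Sum>y\<in>UNIV. p (x, y) * l y (h x)) * c x"
    using p x l c0 by (intro mult_nonneg_nonneg sum_nonneg) (auto simp: joint_density_def)
qed

theorem theorem1:
  fixes M :: "'x measure"
    and p :: "'x \<times> 'y::finite \<Rightarrow> real"
    and q :: "'x \<Rightarrow> 'y \<Rightarrow> real"
    and l :: "'y \<Rightarrow> 'y \<Rightarrow> real"
    and lam :: real
    and h hB :: "'x \<Rightarrow> 'y"
    and c :: "'x \<Rightarrow> real"
  assumes "joint_density M p"
    and "conditional_distribution M p q"
    and "\<And>y y'. 0 \<le> l y y'"
    and "lam > 0"
    and "bounded_improvement_optimal M p l lam (h, c)"
    and "bayes_classifier M q l hB"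
  shows "bounded_improvement_optimal M p l lam (hB, c)"
proof -
  have feasible: "bounded_improvement_feasible M p l lam (h, c)"
    using assms(5) by (simp add: bounded_improvement_optimal_def is_arg_max_def)
  then have "selective_risk M p l hB c \<le> selective_risk M p l h c"
    by (intro selective_risk_bayes_le[OF assms(1,2,3,6)])
      (auto simp: bounded_improvement_feasible_def)
  \<comment> \<open>The nonzero coverage is inherited from \<open>(h, c)\<close>, and the risk bound
    follows by transitivity.\<close>
  then have "bounded_improvement_feasible M p l lam (hB, c)"
    using feasible assms(6) by (auto simp: bounded_improvement_feasible_def bayes_classifier_def)
  \<comment> \<open>The other half of \<open>is_arg_max\<close>, that no feasible pair has larger
    coverage, involves only \<open>c\<close> and transfers unchanged.\<close>
  then show ?thesis
    using assms(5) by (simp add: bounded_improvement_optimal_def is_arg_max_def)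
qed

end
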